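(* Let $\kappa$ be a cardinal. Any (wellordered) breadth-first traversal of the complete $\kappa$-branching tree of depth $\omega$ (viewed as a graph), starting at the root, has order type at least $\kappa^\omega$ (ordinal exponentiation).
   Context: The complete $\kappa$-branching tree of depth $\omega$ is the set $\kappa^{<\omega}$ of finite sequences of elements of $\kappa$, made into an undirected graph by joining each sequence to each of its one-element extensions; its root is the empty sequence. A wellordered traversal of a connected graph $(V,E)$ is a wellordering of $V$ all of whose initial segments induce connected subgraphs; it starts at its least element. Its least neighbor function $p$ takes each vertex other than the minimum to its least neighbor with respect to the wellordering. A breadth-first traversal is a wellordered traversal $\prec$ whose least neighbor function is weakly monotone: $v\preceq w$ implies $p(v)\preceq p(w)$ for all non-minimal $v,w$. *)

theory Defs
  imports "Graph_Theory.Graph_Theory"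
begin

unbundle cardinal_syntax

text \<open>
  As in \<^theory>\<open>Graph_Theory.Digraph\<close>, an undirected graph is a symmetric digraph, and orders are
  reflexive relations, as in \<^theory>\<open>HOL.Order_Relation\<close>.
\<close>

definition complete_tree :: "'a set \<Rightarrow> 'a list pair_pre_digraph" where
  "complete_tree A = \<lparr> pverts = lists A,
     parcs = {(xs, ys). xs \<in> lists A \<and> ys \<in> lists A \<and> (\<exists>a. ys = xs @ [a] \<or> xs = ys @ [a])} \<rparr>"

lemma complete_tree_bidirected: "pair_bidirected_digraph (complete_tree A)"
  by unfold_locales (auto simp: complete_tree_def symmetric_def sym_def)

text \<open>
  The initial segments of a well-order are its order filters, the whole vertex set included.
  The empty segment has to be excluded because the library regards the null graph as disconnected.
\<close>

definition wellordered_traversal :: "('v, 'e) pre_digraph \<Rightarrow> 'v rel \<Rightarrow> bool" where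
  "wellordered_traversal G r \<longleftrightarrow>
     well_order_on (verts G) r \<and>
     (\<forall>S. ofilter r S \<and> S \<noteq> {} \<longrightarrow> Digraph_Component.connected (G \<restriction> S))"

definition start_vertex :: "'v rel \<Rightarrow> 'v" where
  "start_vertex r = wo_rel.minim r (Field r)"

definition least_neighbor :: "('v, 'e) pre_digraph \<Rightarrow> 'v rel \<Rightarrow> 'v \<Rightarrow> 'v" where
  "least_neighbor G r v = wo_rel.minim r {u. u \<rightarrow>\<^bsub>G\<^esub> v}"

definition breadth_first_traversal :: "('v, 'e) pre_digraph \<Rightarrow> 'v rel \<Rightarrow> bool" where
  "breadth_first_traversal G r \<longleftrightarrow>
     wellordered_traversal G r \<and>
     (\<forall>v \<in> verts G - {start_vertex r}. \<forall>w \<in> verts G - {start_vertex r}.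
        (v, w) \<in> r \<longrightarrow> (least_neighbor G r v, least_neighbor G r w) \<in> r)"

text \<open>
  Ordinal exponentiation of well-orders: functions from the exponent to the base that differ from
  the least element of the base at only finitely many places, compared at the largest place where
  they differ. Membership in \<^const>\<open>Func\<close> makes them \<^const>\<open>undefined\<close> off the field of the exponent.
  If the base is empty and the exponent is not, the power is empty.
\<close>

definition fin_supp_funcs :: "'a rel \<Rightarrow> 'b rel \<Rightarrow> ('b \<Rightarrow> 'a) set" where
  "fin_supp_funcs r s =
     {f \<in> Func (Field s) (Field r). finite {x \<in> Field s. f x \<noteq> wo_rel.minim r (Field r)}}"

definition ord_exp :: "'a rel \<Rightarrow> 'b rel \<Rightarrow> ('b \<Rightarrow> 'a) rel"  (infixl \<open>^o\<close> 90) where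
  "r ^o s = {(f, g). f \<in> fin_supp_funcs r s \<and> g \<in> fin_supp_funcs r s \<and>
     (f = g \<or> (\<exists>x \<in> Field s. f x \<noteq> g x \<and> (f x, g x) \<in> r \<and>
        (\<forall>y. (x, y) \<in> s \<and> y \<noteq> x \<longrightarrow> f y = g y)))}"

end

theory Submission
  imports Defs
begin

text \<open>
  In a breadth-first traversal of the tree that starts at the root, the least neighbor of a
  nonempty word is its parent: initial segments are connected, and a path from the root to a word
  passes through the parent (\<open>parent_before_child\<close>). Monotonicity of the least neighbor function
  then says that the children of an earlier word all precede the children of a later one
  (\<open>children_mono\<close>). So each level of the tree precedes the next one (\<open>shorter_before_longer\<close>), and
  two words of equal length are compared at the first letter where they differ.

  Ordering \<open>Field \<kappa>\<close> by how the traversal lists the children \<open>xs @ [a]\<close> of a word \<open>xs\<close> gives a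
  well-order; as \<open>\<kappa>\<close> is a cardinal, it embeds into this order (\<open>children_order_embedding\<close>), by a map
  \<open>h xs\<close> say. An element of \<open>\<kappa>\<^sup>\<omega>\<close> is a base-\<open>\<kappa>\<close> numeral. Descend from the root by its digits, most
  significant digit first, going from \<open>xs\<close> to \<open>xs @ [h xs d]\<close> at the digit \<open>d\<close>. The word reached has
  one letter per digit. A numeral with fewer digits thus ends on an earlier level, and
  numerals with equally many digits are compared at the leading digit where they differ, both in
  \<open>\<kappa>\<^sup>\<omega>\<close> and in the traversal (\<open>digit_path_strict_mono\<close>). So \<open>\<kappa>\<^sup>\<omega>\<close> has a strictly monotone map into the
  traversal, and such a map between well-orders bounds the order type (\<open>strict_mono_ordLeq\<close>).
\<close>

section \<open>Strictly monotone maps into well-orders\<close>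

lemma Well_order_strict_trans:
  assumes "Well_order r" "(x, y) \<in> r - Id" "(y, z) \<in> r - Id"
  shows "(x, z) \<in> r - Id"
  using assms
  by (auto simp: well_order_on_def linear_order_on_def partial_order_on_def preorder_on_def
      dest: transD antisymD)

text \<open>
  A failure of antisymmetry or of transitivity in the total relation \<open>s\<close> is a cycle of distinct
  elements, which \<open>F\<close> would map to a cycle in the strict part of \<open>r\<close>.
\<close>

lemma Well_order_if_strict_mono:
  assumes r: "Well_order r" and refl: "Refl s" and tot: "Total s"
    and mono: "\<And>x y. (x, y) \<in> s \<Longrightarrow> x \<noteq> y \<Longrightarrow> (F x, F y) \<in> r - Id"
  shows "Well_order s"
proof -
  have irr: "(F x, F x) \<notin> r - Id" for x by simp
  have anti: "antisym s"
  proof (rule antisymI, rule ccontr)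
    fix x y assume "(x, y) \<in> s" "(y, x) \<in> s" "x \<noteq> y"
    then show False using Well_order_strict_trans[OF r mono mono, of x y x] irr by blast
  qed
  have "trans s"
  proof (rule transI)
    fix x y z assume xy: "(x, y) \<in> s" and yz: "(y, z) \<in> s"
    show "(x, z) \<in> s"
    proof (rule ccontr)
      assume n: "(x, z) \<notin> s"
      have F: "x \<in> Field s" "z \<in> Field s" using xy yz by (auto simp: Field_def)
      have ne: "x \<noteq> y" "y \<noteq> z" "x \<noteq> z" using n xy yz refl F by (auto simp: refl_on_def)
      with tot F n have zx: "(z, x) \<in> s" by (auto simp: total_on_def)
      have "(F x, F z) \<in> r - Id"
        by (rule Well_order_strict_trans[OF r mono[OF xy ne(1)] mono[OF yz ne(2)]])
      from Well_order_strict_trans[OF r this mono[OF zx ne(3)[symmetric]]] irr show False by blast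
    qed
  qed
  moreover have "wf (s - Id)"
  proof (rule wf_subset)
    show "wf (inv_image (r - Id) F)" using r by (auto simp: well_order_on_def)
    show "s - Id \<subseteq> inv_image (r - Id) F"
    proof (rule subrelI)
      fix x y assume "(x, y) \<in> s - Id"
      then show "(x, y) \<in> inv_image (r - Id) F" using mono[of x y] by (simp add: in_inv_image)
    qed
  qed
  moreover have "s \<subseteq> Field s \<times> Field s" by (auto simp: Field_def)
  ultimately show ?thesis using refl tot anti
    by (auto simp: order_on_defs)
qed

text \<open>
  Otherwise \<open>r\<close> is isomorphic to the part of \<open>s\<close> below some \<open>a\<close>, and \<open>F\<close> followed by the isomorphism is
  a strictly monotone self-map of \<open>s\<close> that moves \<open>a\<close> down. A well-order has no such map: iterating it
  would give an infinite descent.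
\<close>

lemma strict_mono_ordLeq:
  assumes r: "Well_order r" and refl: "Refl s" and tot: "Total s"
    and mono: "\<And>x y. (x, y) \<in> s \<Longrightarrow> x \<noteq> y \<Longrightarrow> (F x, F y) \<in> r - Id"
    and into: "\<And>x. x \<in> Field s \<Longrightarrow> F x \<in> Field r"
  shows "s \<le>o r"
proof (rule ccontr)
  have s: "Well_order s" by (rule Well_order_if_strict_mono[OF r refl tot mono])
  assume "\<not> s \<le>o r"
  with r s have "r <o s" by (simp add: not_ordLeq_iff_ordLess)
  then obtain a where a: "a \<in> Field s" and "r =o Restr s (underS s a)"
    using ordLess_iff_ordIso_Restr[OF s r] by blast
  then obtain g where g: "iso r (Restr s (underS s a)) g"
    by (auto simp: ordIso_def)
  have g_strict: "(g x, g y) \<in> s - Id" if "(x, y) \<in> r - Id" for x y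
  proof -
    have "x \<in> Field r" "y \<in> Field r" using that by (auto simp: Field_def)
    then show ?thesis using that iso_forward[OF _ g, of x y] iso_imp_inj_on[OF g]
      by (auto dest: inj_onD)
  qed
  have g_below: "(g x, a) \<in> s - Id" if "x \<in> Field r" for x
    using that iso_Field[OF g] Field_Restr_subset[of s "underS s a"]
    by (auto simp: underS_def)
  have "wf (s - Id)" using s by (simp add: well_order_on_def)
  then have "(g (F x), x) \<notin> s - Id" for x
  proof (induction x rule: wf_induct_rule)
    case (less x)
    show ?case
    proof
      assume down: "(g (F x), x) \<in> s - Id"
      then have "(g (F (g (F x))), g (F x)) \<in> s - Id" by (intro g_strict mono) auto
      with less.IH[OF down] show False by blast
    qed
  qed
  with g_below[OF into[OF a]] show False by blast
qed

section \<open>Breadth-first traversals of the complete tree\<close>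

locale tree_bf_traversal =
  fixes A :: "'a set" and r :: "'a list rel"
  assumes bft: "breadth_first_traversal (with_proj (complete_tree A)) r"
    and start: "start_vertex r = []"
begin

lemma verts_tree: "verts (with_proj (complete_tree A)) = lists A"
  by (simp add: complete_tree_def)

lemma dominates_tree:
  "u \<rightarrow>\<^bsub>with_proj (complete_tree A)\<^esub> v \<longleftrightarrow>
     u \<in> lists A \<and> v \<in> lists A \<and> (\<exists>a. v = u @ [a] \<or> u = v @ [a])"
  by (simp add: complete_tree_def)

lemma Field_r: "Field r = lists A"
  and Well_order_r: "Well_order r"
proof -
  have w: "well_order_on (lists A) r"
    using bft by (simp add: breadth_first_traversal_def wellordered_traversal_def verts_tree
        del: with_proj_simps)
  show "Field r = lists A" using well_order_on_Field[OF w] by simp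
  with w show "Well_order r" by simp
qed

lemma wo_rel_r: "wo_rel r"
  using Well_order_r by (simp add: wo_rel_def)

lemma not_before_iff: "xs \<in> lists A \<Longrightarrow> ys \<in> lists A \<Longrightarrow> (xs, ys) \<notin> r \<longleftrightarrow> (ys, xs) \<in> r - Id"
  using wo_rel.TOTALS[OF wo_rel_r] wo_rel.ANTISYM[OF wo_rel_r] wo_rel.REFL[OF wo_rel_r]
  by (auto simp: Field_r antisym_def refl_on_def)

lemma root_first: "xs \<in> lists A \<Longrightarrow> ([], xs) \<in> r"
  using wo_rel.minim_least[OF wo_rel_r, of "Field r" xs] start
  by (simp add: start_vertex_def Field_r)

text \<open>
  The only edge into the subtree of words extending \<open>xs @ [a]\<close> comes from \<open>xs\<close>. A path from the root
  to \<open>xs @ [a]\<close> inside the initial segment up to \<open>xs @ [a]\<close> must use this edge.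
\<close>

lemma parent_before_child:
  assumes "xs @ [a] \<in> lists A"
  shows "(xs, xs @ [a]) \<in> r - Id"
proof -
  let ?v = "xs @ [a]" and ?G = "with_proj (complete_tree A)"
  let ?S = "under r ?v"
  have "wo_rel.ofilter r ?S" by (rule wo_rel.under_ofilter[OF wo_rel_r])
  moreover have v: "?v \<in> ?S"
    using assms wo_rel.REFL[OF wo_rel_r] by (auto simp: under_def Field_r refl_on_def)
  ultimately have "Digraph_Component.connected (?G \<restriction> ?S)"
    using bft by (auto simp: breadth_first_traversal_def wellordered_traversal_def)
  moreover have "[] \<in> ?S" using root_first[OF assms] by (simp add: under_def)
  ultimately have "[] \<rightarrow>\<^sup>*\<^bsub>with_proj (mk_symmetric (?G \<restriction> ?S))\<^esub> ?v"
    using v by (auto simp: connected_def strongly_connected_def)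
  moreover have "(\<exists>zs. w = ?v @ zs) \<longrightarrow> xs \<in> ?S"
    if "[] \<rightarrow>\<^sup>*\<^bsub>with_proj (mk_symmetric (?G \<restriction> ?S))\<^esub> w" for w
    using that unfolding reachable_def
  proof (induction rule: rtrancl_on_induct)
    case base
    then show ?case by simp
  next
    case (step u w)
    from step have uS: "u \<in> ?S" by simp
    from step have "\<exists>b. w = u @ [b] \<or> u = w @ [b]"
      by (auto simp: parcs_mk_symmetric complete_tree_def)
    then have "u = xs \<or> (\<exists>zs'. u = ?v @ zs')" if "w = ?v @ zs" for zs
      using that by (cases zs rule: rev_cases) auto
    with step uS show ?case by blast
  qed
  ultimately have "xs \<in> ?S" by blast
  then show ?thesis by (simp add: under_def)
qed

lemma least_neighbor_child:
  assumes "xs @ [a] \<in> lists A"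
  shows "least_neighbor (with_proj (complete_tree A)) r (xs @ [a]) = xs"
  unfolding least_neighbor_def
proof (rule wo_rel.equals_minim[OF wo_rel_r, symmetric])
  let ?nbrs = "{u. u \<rightarrow>\<^bsub>with_proj (complete_tree A)\<^esub> (xs @ [a])}"
  show "?nbrs \<subseteq> Field r" "xs \<in> ?nbrs" using assms unfolding dominates_tree Field_r by auto
  fix b assume "b \<in> ?nbrs"
  then consider "b = xs" | c where "b = (xs @ [a]) @ [c]" "b \<in> lists A"
    unfolding dominates_tree by auto
  then show "(xs, b) \<in> r"
  proof cases
    case 1
    then show ?thesis using parent_before_child[OF assms] wo_rel.REFL[OF wo_rel_r] assms
      by (auto simp: refl_on_def Field_r)
  next
    case 2
    then show ?thesis
      using parent_before_child[of "xs @ [a]" c] parent_before_child[OF assms]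
        wo_rel.TRANS[OF wo_rel_r] by (auto dest: transD)
  qed
qed

text \<open>
  The contrapositive of monotonicity of the least neighbor function: a child of \<open>ys\<close> that is not
  after a child of \<open>xs\<close> would put \<open>ys\<close> before \<open>xs\<close>.
\<close>

lemma children_mono:
  assumes less: "(xs, ys) \<in> r - Id" and x: "xs @ [a] \<in> lists A" and y: "ys @ [b] \<in> lists A"
  shows "(xs @ [a], ys @ [b]) \<in> r - Id"
proof (rule ccontr)
  assume "(xs @ [a], ys @ [b]) \<notin> r - Id"
  with less have "(xs @ [a], ys @ [b]) \<notin> r" by auto
  then have "(ys @ [b], xs @ [a]) \<in> r" using not_before_iff[OF x y] by simp
  moreover have "xs @ [a] \<in> lists A - {[]}" "ys @ [b] \<in> lists A - {[]}" using x y by simp_all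
  moreover have "\<forall>v \<in> lists A - {[]}. \<forall>w \<in> lists A - {[]}. (v, w) \<in> r \<longrightarrow>
      (least_neighbor (with_proj (complete_tree A)) r v,
       least_neighbor (with_proj (complete_tree A)) r w) \<in> r"
    using bft unfolding breadth_first_traversal_def verts_tree start by blast
  ultimately have "(ys, xs) \<in> r"
    using least_neighbor_child[OF x] least_neighbor_child[OF y] by metis
  with less show False using not_before_iff[of ys xs] x y by auto
qed

lemma shorter_before_longer:
  assumes "length xs < length ys" "xs \<in> lists A" "ys \<in> lists A"
  shows "(xs, ys) \<in> r - Id"
  using assms
proof (induction xs arbitrary: ys rule: rev_induct)
  case Nil
  then show ?case using root_first by auto
next
  case (snoc a xs)
  obtain ys' b where ys: "ys = ys' @ [b]" using snoc.prems by (cases ys rule: rev_cases) auto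
  show ?case unfolding ys
  proof (rule children_mono)
    show "(xs, ys') \<in> r - Id" using snoc.prems by (intro snoc.IH) (auto simp: ys)
    show "xs @ [a] \<in> lists A" "ys' @ [b] \<in> lists A" using snoc.prems by (simp_all add: ys)
  qed
qed

text \<open>
  A cardinal is least among the well-orders of its field, and each vertex induces a well-order
  there through its children.
\<close>

lemma children_order_embedding:
  assumes card: "Card_order \<kappa>" and A: "Field \<kappa> = A" and xs: "xs \<in> lists A"
  obtains h where "\<And>a. a \<in> A \<Longrightarrow> h a \<in> A"
    and "\<And>a b. (a, b) \<in> \<kappa> - Id \<Longrightarrow> (xs @ [h a], xs @ [h b]) \<in> r - Id"
proof -
  define s where "s = {(a, b). a \<in> A \<and> b \<in> A \<and> (xs @ [a], xs @ [b]) \<in> r}"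
  have refl_s: "(a, a) \<in> s" if "a \<in> A" for a
    using that xs wo_rel.REFL[OF wo_rel_r] by (auto simp: s_def refl_on_def Field_r)
  then have F: "Field s = A" by (auto simp: Field_def s_def)
  have "Well_order s"
  proof (rule Well_order_if_strict_mono[OF Well_order_r])
    show "Refl s" using refl_s by (auto simp: F refl_on_def)
    show "Total s" unfolding total_on_def F
      using xs wo_rel.TOTALS[OF wo_rel_r] by (auto simp: s_def Field_r)
    show "(xs @ [a], xs @ [b]) \<in> r - Id" if "(a, b) \<in> s" "a \<noteq> b" for a b
      using that by (auto simp: s_def)
  qed
  with card A F have "\<kappa> \<le>o s" by (simp add: card_order_on_def)
  then obtain h where emb: "embed \<kappa> s h" and k: "Well_order \<kappa>"
    by (auto simp: ordLeq_def)
  show thesis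
  proof
    show "h a \<in> A" if "a \<in> A" for a
      using embed_in_Field[OF emb, of a] k that by (simp add: A F)
    show "(xs @ [h a], xs @ [h b]) \<in> r - Id" if "(a, b) \<in> \<kappa> - Id" for a b
    proof -
      from that have "(h a, h b) \<in> s" using embed_compat[OF emb] by (auto simp: compat_def)
      moreover have "h a \<noteq> h b"
        using that embed_inj_on[OF k emb] by (auto dest: inj_onD simp: Field_def)
      ultimately show ?thesis by (simp add: s_def)
    qed
  qed
qed

end

section \<open>From numerals to words\<close>

text \<open>
  The word of length \<open>k\<close> reached from the root by following the \<open>k\<close> leading digits of \<open>f\<close>, read as an
  \<open>n\<close>-digit numeral; \<open>h xs\<close> translates a digit into a child of \<open>xs\<close>.
\<close>

primrec digit_path :: "('a list \<Rightarrow> 'a \<Rightarrow> 'a) \<Rightarrow> (nat \<Rightarrow> 'a) \<Rightarrow> nat \<Rightarrow> nat \<Rightarrow> 'a list" where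
  "digit_path h f n 0 = []"
| "digit_path h f n (Suc k) = digit_path h f n k @ [h (digit_path h f n k) (f (n - Suc k))]"

lemma length_digit_path: "length (digit_path h f n k) = k"
  by (induction k) auto

lemma digit_path_in_lists:
  assumes "\<And>xs a. xs \<in> lists A \<Longrightarrow> a \<in> A \<Longrightarrow> h xs a \<in> A" and "\<And>i. f i \<in> A"
  shows "digit_path h f n k \<in> lists A"
proof (induction k)
  case (Suc k)
  with assms(1)[OF Suc assms(2)] show ?case by simp
qed simp

lemma digit_path_cong:
  assumes "\<And>i. n - k \<le> i \<Longrightarrow> f i = g i" "k \<le> n"
  shows "digit_path h f n k = digit_path h g n k"
  using assms
proof (induction k)
  case (Suc k)
  have "digit_path h f n k = digit_path h g n k"
    by (rule Suc.IH) (use Suc.prems in auto)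
  then show ?case using Suc.prems(1)[of "n - Suc k"] by simp
qed simp

text \<open>
  The two paths agree until they read digit \<open>x\<close>, where they branch in the order of the digits. From
  then on \<open>children_mono\<close> preserves the order whatever the remaining digits are.
\<close>

lemma (in tree_bf_traversal) digit_path_strict_mono:
  assumes h_in: "\<And>xs a. xs \<in> lists A \<Longrightarrow> a \<in> A \<Longrightarrow> h xs a \<in> A"
    and h_mono: "\<And>xs a b. xs \<in> lists A \<Longrightarrow> (a, b) \<in> \<kappa> - Id \<Longrightarrow> (xs @ [h xs a], xs @ [h xs b]) \<in> r - Id"
    and f: "\<And>i. f i \<in> A" and g: "\<And>i. g i \<in> A"
    and differ: "(f x, g x) \<in> \<kappa> - Id" and agree: "\<And>y. x < y \<Longrightarrow> f y = g y" and "x < n"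
  shows "(digit_path h f n n, digit_path h g n n) \<in> r - Id"
proof -
  have f_in: "digit_path h f n k \<in> lists A" and g_in: "digit_path h g n k \<in> lists A" for k
    by (rule digit_path_in_lists; rule h_in f g; assumption)+
  \<comment> \<open>the number of digits read before digit \<open>x\<close>\<close>
  define m where "m = n - Suc x"
  have m: "n - Suc m = x" using \<open>x < n\<close> by (simp add: m_def)
  have prefix: "digit_path h f n m = digit_path h g n m"
    using \<open>x < n\<close> agree by (intro digit_path_cong) (auto simp: m_def)
  then have split: "(digit_path h f n (Suc m), digit_path h g n (Suc m)) \<in> r - Id"
    using h_mono[OF f_in[of m] differ] by (simp only: digit_path.simps m prefix)
  have "(digit_path h f n k, digit_path h g n k) \<in> r - Id" if "Suc m \<le> k" for k
    using that
  proof (induction k rule: dec_induct)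
    case base
    show ?case by (rule split)
  next
    case (step k)
    have "digit_path h f n (Suc k) \<in> lists A" "digit_path h g n (Suc k) \<in> lists A"
      by (rule f_in g_in)+
    then show ?case unfolding digit_path.simps by (rule children_mono[OF step.IH])
  qed
  then show ?thesis using \<open>x < n\<close> by (simp add: m_def)
qed

lemma ord_exp_refl: "f \<in> fin_supp_funcs r s \<Longrightarrow> (f, f) \<in> r ^o s"
  by (simp add: ord_exp_def)

lemma Field_ord_exp: "Field (r ^o s) = fin_supp_funcs r s"
  using ord_exp_refl[of _ r s] by (fastforce simp: Field_def ord_exp_def)

lemma ord_exp_natLeq_iff:
  "(f, g) \<in> \<kappa> ^o natLeq \<longleftrightarrow> f \<in> fin_supp_funcs \<kappa> natLeq \<and> g \<in> fin_supp_funcs \<kappa> natLeq \<and>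
     (f = g \<or> (\<exists>x. (f x, g x) \<in> \<kappa> - Id \<and> (\<forall>y > x. f y = g y)))"
proof -
  have "(x, y) \<in> natLeq \<and> y \<noteq> x \<longleftrightarrow> x < y" for x y by (auto simp: natLeq_def)
  then show ?thesis by (auto simp: ord_exp_def Field_natLeq)
qed

lemma Total_ord_exp_natLeq:
  assumes \<kappa>: "Well_order \<kappa>"
  shows "Total (\<kappa> ^o natLeq)"
  unfolding total_on_def Field_ord_exp
proof (intro ballI impI)
  fix f g assume f: "f \<in> fin_supp_funcs \<kappa> natLeq" and g: "g \<in> fin_supp_funcs \<kappa> natLeq"
    and "f \<noteq> g"
  let ?D = "{x. f x \<noteq> g x}" and ?z = "wo_rel.minim \<kappa> (Field \<kappa>)"
  have "finite ({x. f x \<noteq> ?z} \<union> {x. g x \<noteq> ?z})"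
    using f g by (simp add: fin_supp_funcs_def Field_natLeq)
  then have fin: "finite ?D" by (rule finite_subset[rotated]) auto
  have "?D \<noteq> {}" using \<open>f \<noteq> g\<close> by auto
  define x where "x = Max ?D"
  have x: "f x \<noteq> g x" using Max_in[OF fin \<open>?D \<noteq> {}\<close>] by (simp add: x_def)
  have above: "f y = g y" if "x < y" for y
    using Max_ge[OF fin, of y] that by (auto simp: x_def)
  have "f x \<in> Field \<kappa>" "g x \<in> Field \<kappa>"
    using f g by (auto simp: fin_supp_funcs_def Func_def Field_natLeq)
  then have "(f x, g x) \<in> \<kappa> - Id \<or> (g x, f x) \<in> \<kappa> - Id"
    using \<kappa> wo_rel.TOTALS[of \<kappa>] x by (auto simp: wo_rel_def)
  then show "(f, g) \<in> \<kappa> ^o natLeq \<or> (g, f) \<in> \<kappa> ^o natLeq"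
    unfolding ord_exp_natLeq_iff using f g above by metis
qed

theorem corollary5p7:
  fixes \<kappa> :: "'k rel" and r :: "'k list rel"
  assumes "Card_order \<kappa>"
    and "breadth_first_traversal (with_proj (complete_tree (Field \<kappa>))) r"
    and "start_vertex r = []"
  shows "\<kappa> ^o natLeq \<le>o r"
proof -
  interpret tree_bf_traversal "Field \<kappa>" r by unfold_locales fact+
  have \<kappa>: "Well_order \<kappa>" using assms(1) by (simp add: card_order_on_def)
  then have wo: "wo_rel \<kappa>" by (simp add: wo_rel_def)
  have "\<exists>h. (\<forall>a \<in> Field \<kappa>. h a \<in> Field \<kappa>) \<and>
      (\<forall>a b. (a, b) \<in> \<kappa> - Id \<longrightarrow> (xs @ [h a], xs @ [h b]) \<in> r - Id)"
    if "xs \<in> lists (Field \<kappa>)" for xs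
    by (rule children_order_embedding[OF assms(1) refl that]) blast
  then obtain h where
    h_in: "\<And>xs a. xs \<in> lists (Field \<kappa>) \<Longrightarrow> a \<in> Field \<kappa> \<Longrightarrow> h xs a \<in> Field \<kappa>" and
    h_mono: "\<And>xs a b. xs \<in> lists (Field \<kappa>) \<Longrightarrow> (a, b) \<in> \<kappa> - Id \<Longrightarrow>
      (xs @ [h xs a], xs @ [h xs b]) \<in> r - Id"
    by metis
  define z where "z = wo_rel.minim \<kappa> (Field \<kappa>)"
  define digits where "digits f = (LEAST n. \<forall>i \<ge> n. f i = z)" for f :: "nat \<Rightarrow> 'k"
  define F where "F f = digit_path h f (digits f) (digits f)" for f
  have in_Field: "f i \<in> Field \<kappa>" if "f \<in> fin_supp_funcs \<kappa> natLeq" for f i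
    using that by (auto simp: fin_supp_funcs_def Func_def Field_natLeq)
  have beyond_digits: "f i = z" if f: "f \<in> fin_supp_funcs \<kappa> natLeq" and i: "digits f \<le> i" for f i
  proof -
    have "finite {i. f i \<noteq> z}" using f by (simp add: fin_supp_funcs_def Field_natLeq z_def)
    then obtain n where "\<forall>i \<in> {i. f i \<noteq> z}. i < n" using finite_nat_set_iff_bounded by blast
    then have "\<forall>i \<ge> n. f i = z" by (meson leD mem_Collect_eq)
    then have "\<forall>i \<ge> digits f. f i = z" unfolding digits_def by (rule LeastI)
    with i show ?thesis by blast
  qed
  have F_in: "F f \<in> lists (Field \<kappa>)" if "f \<in> fin_supp_funcs \<kappa> natLeq" for f
    unfolding F_def by (rule digit_path_in_lists) (use h_in in_Field[OF that] in blast)+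
  show ?thesis
  proof (rule strict_mono_ordLeq[OF Well_order_r])
    show "Refl (\<kappa> ^o natLeq)" by (auto simp: refl_on_def Field_ord_exp ord_exp_refl)
    show "Total (\<kappa> ^o natLeq)" by (rule Total_ord_exp_natLeq[OF \<kappa>])
    show "F f \<in> Field r" if "f \<in> Field (\<kappa> ^o natLeq)" for f
      using that F_in unfolding Field_ord_exp Field_r by blast
  next
    fix f g assume "(f, g) \<in> \<kappa> ^o natLeq" "f \<noteq> g"
    then obtain x where f: "f \<in> fin_supp_funcs \<kappa> natLeq" and g: "g \<in> fin_supp_funcs \<kappa> natLeq"
      and differ: "(f x, g x) \<in> \<kappa> - Id" and agree: "\<And>y. x < y \<Longrightarrow> f y = g y"
      by (auto simp: ord_exp_natLeq_iff)
    have x_less: "x < digits g"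
    proof (rule ccontr)
      \<comment> \<open>\<open>f x\<close> would lie strictly below the least element of \<open>\<kappa>\<close>.\<close>
      assume "\<not> x < digits g"
      then have "g x = z" using beyond_digits[OF g] by simp
      moreover have "(z, f x) \<in> \<kappa>"
        unfolding z_def using wo_rel.minim_least[OF wo] in_Field[OF f] by blast
      ultimately show False using differ wo_rel.ANTISYM[OF wo] by (auto dest: antisymD)
    qed
    have "\<forall>i \<ge> digits g. f i = z" using agree x_less beyond_digits[OF g] by simp
    then have "digits f \<le> digits g" unfolding digits_def[of f] by (rule Least_le)
    then consider "digits f < digits g" | "digits f = digits g" by linarith
    then show "(F f, F g) \<in> r - Id"
    proof cases
      case 1
      then show ?thesis
        by (intro shorter_before_longer F_in f g) (simp add: F_def length_digit_path)
    next
      case 2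
      show ?thesis unfolding F_def 2
        using h_in h_mono in_Field[OF f] in_Field[OF g] differ agree x_less
        by (rule digit_path_strict_mono)
    qed
  qed
qed

end
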